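(* The additively idempotent semiring $S_7^0$ is nonfinitely based; that is, there is no finite set of identities (in the signature $(+,\cdot)$) that defines the variety $\mathsf{V}(S_7^0)$ generated by $S_7^0$.
   Context: A semiring is an algebra $(S,+,\cdot)$ with two binary operations such that $(S,+)$ is a commutative semigroup, $(S,\cdot)$ is a semigroup, and the distributive laws $(x+y)z\approx xz+yz$ and $x(y+z)\approx xy+xz$ hold. An additively idempotent semiring (ai-semiring) is a semiring whose additive reduct is a semilattice, i.e. also $x+x\approx x$. The signature consists only of the two binary operations $+$ and $\cdot$ (no constants). A variety is finitely based if it can be defined by finitely many identities, and nonfinitely based otherwise. An algebra $A$ is (non)finitely based if the variety $\mathsf{V}(A)$ it generates is (non)finitely based. $S_7$ is the 3-element ai-semiring $\{1,a,0\}$ in which: $1+1=1$, $a+a=a$, $0+0=0$, and the sum of any two distinct elements is $0$; multiplication is commutative with $1$ as identity element, $a\cdot a=0$, and $0$ is a multiplicative zero ($0\cdot x=x\cdot 0=0$ for all $x$). $S_7^0$ is the 4-element ai-semiring $\{1,a,0,\infty\}$ obtained from $S_7$ by adjoining a new element $\infty$ with $x+\infty=\infty+x=x$ and $x\cdot\infty=\infty\cdot x=\infty$ for all $x\in\{1,a,0,\infty\}$, the operations on $\{1,a,0\}$ being those of $S_7$. *)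

theory Defs
  imports "HOL-Library.FuncSet"
begin

section \<open>Algebras and identities of the signature (+, *)\<close>

record 'a alg =
  carrier :: "'a set"
  add :: "'a \<Rightarrow> 'a \<Rightarrow> 'a"
  mult :: "'a \<Rightarrow> 'a \<Rightarrow> 'a"

definition algebra :: "'a alg \<Rightarrow> bool" where
  "algebra A \<longleftrightarrow> carrier A \<noteq> {} \<and>
     (\<forall>x\<in>carrier A. \<forall>y\<in>carrier A. add A x y \<in> carrier A \<and> mult A x y \<in> carrier A)"

definition ai_semiring :: "'a alg \<Rightarrow> bool" where
  "ai_semiring A \<longleftrightarrow> algebra A \<and>
     (\<forall>x\<in>carrier A. \<forall>y\<in>carrier A. \<forall>z\<in>carrier A.
        add A (add A x y) z = add A x (add A y z) \<and>
        add A x y = add A y x \<and>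
        add A x x = x \<and>
        mult A (mult A x y) z = mult A x (mult A y z) \<and>
        mult A (add A x y) z = add A (mult A x z) (mult A y z) \<and>
        mult A x (add A y z) = add A (mult A x y) (mult A x z))"

datatype trm = Var nat | Plus trm trm | Times trm trm

type_synonym identity = "trm \<times> trm"

primrec eval :: "'a alg \<Rightarrow> (nat \<Rightarrow> 'a) \<Rightarrow> trm \<Rightarrow> 'a" where
  "eval A \<sigma> (Var n) = \<sigma> n"
| "eval A \<sigma> (Plus s t) = add A (eval A \<sigma> s) (eval A \<sigma> t)"
| "eval A \<sigma> (Times s t) = mult A (eval A \<sigma> s) (eval A \<sigma> t)"

definition satisfies :: "'a alg \<Rightarrow> identity \<Rightarrow> bool" where
  "satisfies A e \<longleftrightarrow>
     (\<forall>\<sigma>. (\<forall>n. \<sigma> n \<in> carrier A) \<longrightarrow> eval A \<sigma> (fst e) = eval A \<sigma> (snd e))"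


section \<open>The variety generated by an algebra\<close>

definition power_alg :: "'a alg \<Rightarrow> 'i set \<Rightarrow> ('i \<Rightarrow> 'a) alg" where
  "power_alg A I =
     \<lparr>carrier = I \<rightarrow>\<^sub>E carrier A,
      add = (\<lambda>f g. \<lambda>i\<in>I. add A (f i) (g i)),
      mult = (\<lambda>f g. \<lambda>i\<in>I. mult A (f i) (g i))\<rparr>"

definition subalgebra :: "'a alg \<Rightarrow> 'a alg \<Rightarrow> bool" where
  "subalgebra C A \<longleftrightarrow> algebra C \<and> carrier C \<subseteq> carrier A \<and>
     (\<forall>x\<in>carrier C. \<forall>y\<in>carrier C. add C x y = add A x y \<and> mult C x y = mult A x y)"

definition homomorphism :: "('a \<Rightarrow> 'b) \<Rightarrow> 'a alg \<Rightarrow> 'b alg \<Rightarrow> bool" where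
  "homomorphism h A B \<longleftrightarrow> h \<in> carrier A \<rightarrow> carrier B \<and>
     (\<forall>x\<in>carrier A. \<forall>y\<in>carrier A.
        h (add A x y) = add B (h x) (h y) \<and> h (mult A x y) = mult B (h x) (h y))"

definition in_HSP :: "'i set \<Rightarrow> 'a alg \<Rightarrow> 'b alg \<Rightarrow> bool" where
  "in_HSP I A B \<longleftrightarrow> algebra B \<and>
     (\<exists>C h. subalgebra C (power_alg A I) \<and> homomorphism h C B \<and> h ` carrier C = carrier B)"

text \<open>
  The variety generated by \<open>A\<close> is the class HSP(\<open>A\<close>) of homomorphic images of subalgebras of
  direct powers of \<open>A\<close>.  Since one cannot quantify over the type of the exponent, exponents
  are taken inside the type \<open>'b \<Rightarrow> 'a\<close>; by \<open>in_HSP_imp_in_variety\<close> below, exponents of any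
  other type give nothing more.
\<close>

definition in_variety :: "'a alg \<Rightarrow> 'b alg \<Rightarrow> bool" where
  "in_variety A B \<longleftrightarrow> (\<exists>I :: ('b \<Rightarrow> 'a) set. in_HSP I A B)"

lemma in_HSP_imp_in_variety:
  fixes I :: "'i set" and A :: "'a alg" and B :: "'b alg"
  assumes "in_HSP I A B"
  shows "in_variety A B"
proof -
  obtain C h where B: "algebra B" and C: "subalgebra C (power_alg A I)"
    and h: "homomorphism h C B" and surj: "h ` carrier C = carrier B"
    using assms unfolding in_HSP_def by blast
  have "\<forall>b\<in>carrier B. \<exists>x\<in>carrier C. h x = b" using surj by (metis imageE)
  then obtain c where c: "\<And>b. b \<in> carrier B \<Longrightarrow> c b \<in> carrier C \<and> h (c b) = b" by metis
  obtain b0 where b0: "b0 \<in> carrier B" using B unfolding algebra_def by blast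
  define c' where "c' b = (if b \<in> carrier B then c b else c b0)" for b
  have c'C: "c' b \<in> carrier C" for b using c b0 by (simp add: c'_def)
  have hc': "h (c' b) = b" if "b \<in> carrier B" for b using c that by (simp add: c'_def)
  have CA: "carrier C \<subseteq> I \<rightarrow>\<^sub>E carrier A"
    using C unfolding subalgebra_def power_alg_def by simp
  have Cadd: "add C x y = (\<lambda>i\<in>I. add A (x i) (y i))" and
       Cmult: "mult C x y = (\<lambda>i\<in>I. mult A (x i) (y i))"
    if "x \<in> carrier C" "y \<in> carrier C" for x y
    using C that unfolding subalgebra_def power_alg_def by auto
  have Ccl: "add C x y \<in> carrier C" "mult C x y \<in> carrier C"
    if "x \<in> carrier C" "y \<in> carrier C" for x y
    using C that unfolding subalgebra_def algebra_def by auto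
  define p where "p i = (\<lambda>b. c' b i)" for i
  define J where "J = p ` I"
  define r where "r d = (\<lambda>i\<in>I. d (p i))" for d :: "('b \<Rightarrow> 'a) \<Rightarrow> 'a"
  define D where "D = (power_alg A J)\<lparr>carrier := {d \<in> J \<rightarrow>\<^sub>E carrier A. r d \<in> carrier C}\<rparr>"
  have Dcar: "d \<in> carrier D \<longleftrightarrow> d \<in> J \<rightarrow>\<^sub>E carrier A \<and> r d \<in> carrier C" for d
    by (simp add: D_def)
  have Dadd: "add D d e = (\<lambda>j\<in>J. add A (d j) (e j))" and
       Dmult: "mult D d e = (\<lambda>j\<in>J. mult A (d j) (e j))" for d e
    by (simp_all add: D_def power_alg_def)
  have radd: "r (add D d e) = add C (r d) (r e)" and rmult: "r (mult D d e) = mult C (r d) (r e)"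
    if "d \<in> carrier D" "e \<in> carrier D" for d e
    using that by (auto simp: Dcar Cadd Cmult Dadd Dmult r_def J_def fun_eq_iff)
  have Acl: "add A (d j) (e j) \<in> carrier A" "mult A (d j) (e j) \<in> carrier A"
    if de: "d \<in> carrier D" "e \<in> carrier D" and j: "j \<in> J" for d e j
  proof -
    obtain i where i: "i \<in> I" "j = p i" using j by (auto simp: J_def)
    have rd: "r d \<in> carrier C" "r e \<in> carrier C" using de by (auto simp: Dcar)
    have "add C (r d) (r e) i \<in> carrier A" "mult C (r d) (r e) i \<in> carrier A"
      using Ccl[OF rd] CA i by (auto dest!: subsetD[OF CA])
    then show "add A (d j) (e j) \<in> carrier A" "mult A (d j) (e j) \<in> carrier A"
      using i unfolding Cadd[OF rd] Cmult[OF rd] by (simp_all add: r_def)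
  qed
  have Dcl: "add D d e \<in> carrier D \<and> mult D d e \<in> carrier D"
    if "d \<in> carrier D" "e \<in> carrier D" for d e
  proof -
    have "r (add D d e) \<in> carrier C" "r (mult D d e) \<in> carrier C"
      using that Ccl by (simp_all add: radd rmult Dcar)
    moreover have "add D d e \<in> J \<rightarrow>\<^sub>E carrier A" "mult D d e \<in> J \<rightarrow>\<^sub>E carrier A"
      using Acl[OF that] by (auto simp: Dadd Dmult)
    ultimately show ?thesis by (simp add: Dcar)
  qed
  define ev where "ev b = (\<lambda>j\<in>J. j b)" for b :: 'b
  have rev: "r (ev b) = c' b" for b
  proof
    fix i show "r (ev b) i = c' b i"
    proof (cases "i \<in> I")
      case True then show ?thesis by (simp add: r_def ev_def J_def p_def)
    next
      case False
      have "c' b \<in> extensional I" using CA c'C[of b] by (auto simp: PiE_def)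
      then show ?thesis using False by (simp add: r_def extensional_def)
    qed
  qed
  have evD: "ev b \<in> carrier D" for b
  proof -
    have "c' b i \<in> carrier A" if "i \<in> I" for i using CA c'C[of b] that by auto
    then have "ev b \<in> J \<rightarrow>\<^sub>E carrier A" by (auto simp: ev_def J_def p_def)
    then show ?thesis by (simp add: Dcar rev c'C)
  qed
  have "carrier D \<noteq> {}" using evD by blast
  then have "algebra D" using Dcl unfolding algebra_def by blast
  then have 1: "subalgebra D (power_alg A J)"
    unfolding subalgebra_def by (auto simp: D_def power_alg_def)
  have 2: "homomorphism (h \<circ> r) D B"
    using h unfolding homomorphism_def by (auto simp: radd rmult Dcar)
  have "b \<in> (h \<circ> r) ` carrier D" if "b \<in> carrier B" for b
    using evD[of b] rev[of b] hc'[OF that] by (metis comp_apply image_eqI)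
  moreover have "(h \<circ> r) ` carrier D \<subseteq> carrier B"
    using 2 unfolding homomorphism_def by blast
  ultimately have 3: "(h \<circ> r) ` carrier D = carrier B" by blast
  show ?thesis
    unfolding in_variety_def in_HSP_def using B 1 2 3 by blast
qed

text \<open>
  A set of identities defines the variety if the members of the variety are exactly its models
  among all algebras of the signature.  The class of all algebras is rendered by the algebras
  whose carrier is a subset of a type \<open>'u\<close>.  This is adequate for every infinite type \<open>'u\<close>
  and a finite (or countable) algebra \<open>A\<close>, because a variety is determined by its finitely
  generated, hence countable, members.  For a finite type \<open>'u\<close> it would not be.
\<close>

definition finitely_based :: "'u itself \<Rightarrow> 'a alg \<Rightarrow> bool" where
  "finitely_based U A \<longleftrightarrow>
     (\<exists>E :: identity set. finite E \<and>
        (\<forall>B :: 'u alg. algebra B \<longrightarrow> (in_variety A B \<longleftrightarrow> (\<forall>e\<in>E. satisfies B e))))"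


section \<open>The ai-semirings \<open>S\<^sub>7\<close> and \<open>S\<^sub>7\<^sup>0\<close>\<close>

datatype s7 = One7 | A7 | Zero7

definition s7_add :: "s7 \<Rightarrow> s7 \<Rightarrow> s7" where
  "s7_add x y = (if x = y then x else Zero7)"

fun s7_mult :: "s7 \<Rightarrow> s7 \<Rightarrow> s7" where
  "s7_mult One7 y = y"
| "s7_mult x One7 = x"
| "s7_mult _ _ = Zero7"

text \<open>The adjoined element \<open>\<infinity>\<close> is \<^const>\<open>None\<close>.\<close>

fun s70_add :: "s7 option \<Rightarrow> s7 option \<Rightarrow> s7 option" where
  "s70_add None y = y"
| "s70_add x None = x"
| "s70_add (Some x) (Some y) = Some (s7_add x y)"

fun s70_mult :: "s7 option \<Rightarrow> s7 option \<Rightarrow> s7 option" where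
  "s70_mult (Some x) (Some y) = Some (s7_mult x y)"
| "s70_mult _ _ = None"

definition S7 :: "s7 alg" where
  "S7 = \<lparr>carrier = UNIV, add = s7_add, mult = s7_mult\<rparr>"

definition S70 :: "s7 option alg" where
  "S70 = \<lparr>carrier = UNIV, add = s70_add, mult = s70_mult\<rparr>"

lemma s7_laws:
  "s7_add (s7_add x y) z = s7_add x (s7_add y z)" "s7_add x y = s7_add y x"
  "s7_add x x = x" "s7_mult (s7_mult x y) z = s7_mult x (s7_mult y z)"
  "s7_mult (s7_add x y) z = s7_add (s7_mult x z) (s7_mult y z)"
  "s7_mult x (s7_add y z) = s7_add (s7_mult x y) (s7_mult x z)"
  by (cases x; cases y; cases z; simp add: s7_add_def)+

lemma ai_semiring_S7: "ai_semiring S7"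
  unfolding ai_semiring_def algebra_def S7_def alg.simps
  by (intro conjI ballI UNIV_I UNIV_not_empty; rule s7_laws)

lemma s70_laws:
  "s70_add (s70_add x y) z = s70_add x (s70_add y z)" "s70_add x y = s70_add y x"
  "s70_add x x = x" "s70_mult (s70_mult x y) z = s70_mult x (s70_mult y z)"
  "s70_mult (s70_add x y) z = s70_add (s70_mult x z) (s70_mult y z)"
  "s70_mult x (s70_add y z) = s70_add (s70_mult x y) (s70_mult x z)"
  by (cases x; cases y; cases z; simp?; rule s7_laws)+

lemma ai_semiring_S70: "ai_semiring S70"
  unfolding ai_semiring_def algebra_def S70_def alg.simps
  by (intro conjI ballI UNIV_I UNIV_not_empty; rule s70_laws)

end

theory Submission
  imports Defs
begin

text \<open>
  Let \<open>n \<ge> 2\<close> be even and let \<open>C\<close> be the cycle with the odd number \<open>n + 1\<close> of vertices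
  \<open>0, \<dots>, n\<close>.  The identity \<open>cycle_identity n\<close> says that the product \<open>x\<^sub>0 x\<^sub>1 \<cdots> x\<^sub>n\<close> lies below the
  sum of the products \<open>x\<^sub>i x\<^sub>j\<close> over the edges of \<open>C\<close>, where \<open>x\<close> is below \<open>y\<close> if \<open>x + y = y\<close>.
  It holds in \<open>S\<^sub>7\<^sup>0\<close>: for the sum to be \<open>a\<close>, every edge must have one end with value \<open>a\<close>
  and the other with value \<open>1\<close>, which would be a 2-colouring of an odd cycle.  In the other
  cases the claim is clear: if some variable is \<open>\<infinity>\<close>, then so is the product; if the sum is
  \<open>1\<close>, then all variables are \<open>1\<close>; and \<open>0\<close> is the greatest element.

  These identities do not follow from identities in few variables.  To a graph one attaches
  the ai-semiring \<open>graph_alg\<close> of all nonempty sets of vertices, one element \<open>Edge\<close> for all sums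
  of edges, and a greatest element \<open>Top\<close> for everything else.  Sending \<open>x\<^sub>i\<close> to the vertex \<open>i\<close>
  makes the sum over \<open>C\<close> equal to \<open>Edge\<close>, while a product of three or more factors is \<open>Top\<close>; so
  the semiring of \<open>C\<close> violates \<open>cycle_identity n\<close>.

  On the other hand, the semiring of a symmetric graph satisfies every identity \<open>s \<approx> t\<close> of
  \<open>S\<^sub>7\<^sup>0\<close> whose sides have at most \<open>m\<close> variables each, provided that any set of at most \<open>m\<close> vertices induces a
  bipartite graph (\<open>graph_alg_satisfies\<close>).  The main case is that \<open>t\<close> takes the value \<open>Edge\<close>.
  Then each word of \<open>t\<close> is one letter with value \<open>Edge\<close> or a product \<open>x y\<close> of two letters
  whose values are completely joined sets of vertices.  Choosing one vertex for each letter
  gives at most \<open>m\<close> vertices.  Now let \<open>q\<close> be a word of \<open>s\<close>.  A 2-colouring of the chosen vertices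
  turns into two assignments of \<open>a\<close> and \<open>1\<close> to the letters of \<open>q\<close>, one for each colour class,
  with \<open>\<infinity>\<close> for all other variables, under which \<open>t\<close> takes the value \<open>a\<close> in \<open>S\<^sub>7\<^sup>0\<close>.  Hence \<open>q\<close>
  has exactly one letter with value \<open>a\<close> under both of them, and this is only possible if \<open>q\<close>
  already occurs in \<open>t\<close>, up to the order of its letters.

  A cycle with more than \<open>m\<close> vertices has this property, because removing a vertex
  leaves a path.  For a finite set of identities of \<open>S\<^sub>7\<^sup>0\<close> a long enough odd cycle therefore
  gives a model that is not in the variety.
\<close>

section \<open>Terms as sums of words\<close>

primrec words :: "trm \<Rightarrow> nat list set" where
  "words (Var x) = {[x]}"
| "words (Plus s t) = words s \<union> words t"
| "words (Times s t) = {p @ q | p q. p \<in> words s \<and> q \<in> words t}"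

definition vars :: "trm \<Rightarrow> nat set" where
  "vars t = (\<Union>p\<in>words t. set p)"

lemma Nil_notin_words: "[] \<notin> words t"
  by (induction t) auto

lemma finite_words: "finite (words t)"
proof (induction t)
  case (Times s t)
  have "words (Times s t) = (\<lambda>(p, q). p @ q) ` (words s \<times> words t)" by auto
  then show ?case using Times by simp
qed simp_all

lemma finite_vars: "finite (vars t)"
  by (simp add: vars_def finite_words)

text \<open>The clause for the empty word is an arbitrary default: there is no unit in the signature.\<close>

fun word_val :: "'a alg \<Rightarrow> (nat \<Rightarrow> 'a) \<Rightarrow> nat list \<Rightarrow> 'a" where
  "word_val A \<sigma> [] = undefined"
| "word_val A \<sigma> [x] = \<sigma> x"
| "word_val A \<sigma> (x # y # w) = mult A (\<sigma> x) (word_val A \<sigma> (y # w))"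

definition below :: "'a alg \<Rightarrow> 'a \<Rightarrow> 'a \<Rightarrow> bool" where
  "below A x y \<longleftrightarrow> add A x y = y"

locale valued_ai_semiring =
  fixes A :: "'a alg" and \<sigma> :: "nat \<Rightarrow> 'a"
  assumes ai: "ai_semiring A" and \<sigma>: "\<And>n. \<sigma> n \<in> carrier A"
begin

lemma closed [simp]:
  assumes "x \<in> carrier A" "y \<in> carrier A"
  shows "add A x y \<in> carrier A" "mult A x y \<in> carrier A"
  using ai assms unfolding ai_semiring_def algebra_def by auto

lemma laws:
  assumes "x \<in> carrier A" "y \<in> carrier A" "z \<in> carrier A"
  shows "add A (add A x y) z = add A x (add A y z)" "add A x y = add A y x" "add A x x = x"
    "mult A (mult A x y) z = mult A x (mult A y z)"
    "mult A (add A x y) z = add A (mult A x z) (mult A y z)"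
    "mult A x (add A y z) = add A (mult A x y) (mult A x z)"
  using ai assms unfolding ai_semiring_def by blast+

lemma eval_closed [simp]: "eval A \<sigma> t \<in> carrier A"
  by (induction t) (auto simp: \<sigma>)

lemma word_val_closed: "w \<noteq> [] \<Longrightarrow> word_val A \<sigma> w \<in> carrier A"
  by (induction w rule: induct_list012) (auto simp: \<sigma>)

lemma word_val_append:
  "p \<noteq> [] \<Longrightarrow> q \<noteq> [] \<Longrightarrow> word_val A \<sigma> (p @ q) = mult A (word_val A \<sigma> p) (word_val A \<sigma> q)"
proof (induction p rule: induct_list012)
  case (2 x)
  then show ?case by (cases q) auto
next
  case (3 x y w)
  then show ?case by (simp add: laws(4) \<sigma> word_val_closed)
qed simp

lemma below_add_iff:
  assumes "x \<in> carrier A" "y \<in> carrier A" "z \<in> carrier A"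
  shows "below A (add A x y) z \<longleftrightarrow> below A x z \<and> below A y z"
  using assms unfolding below_def by (metis closed(1) laws(1-3))

lemma below_antisym:
  "x \<in> carrier A \<Longrightarrow> y \<in> carrier A \<Longrightarrow> below A x y \<Longrightarrow> below A y x \<Longrightarrow> x = y"
  unfolding below_def using laws(2) by metis

text \<open>
  By distributivity a term is the join of its words.  The additive map \<open>h\<close> makes the
  induction work: for a product, \<open>h\<close> is composed with multiplication by the other factor.
\<close>

lemma additive_eval_below_iff:
  assumes "\<And>x. x \<in> carrier A \<Longrightarrow> h x \<in> carrier A"
    and "\<And>x y. x \<in> carrier A \<Longrightarrow> y \<in> carrier A \<Longrightarrow> h (add A x y) = add A (h x) (h y)"
    and "z \<in> carrier A"
  shows "below A (h (eval A \<sigma> t)) z \<longleftrightarrow> (\<forall>p\<in>words t. below A (h (word_val A \<sigma> p)) z)"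
  using assms(1,2)
proof (induction t arbitrary: h)
  case (Var x)
  then show ?case by simp
next
  case (Plus s t)
  then show ?case using assms(3) by (auto simp: below_add_iff)
next
  case (Times s t)
  have word: "word_val A \<sigma> p \<in> carrier A" if "p \<in> words u" for p u
    using that Nil_notin_words word_val_closed by metis
  have "below A (h (eval A \<sigma> (Times s t))) z \<longleftrightarrow>
      (\<forall>p\<in>words s. below A (h (mult A (word_val A \<sigma> p) (eval A \<sigma> t))) z)"
    using Times.IH(1)[of "\<lambda>x. h (mult A x (eval A \<sigma> t))"] Times.prems by (simp add: laws(5))
  also have "\<dots> \<longleftrightarrow>
      (\<forall>p\<in>words s. \<forall>q\<in>words t. below A (h (mult A (word_val A \<sigma> p) (word_val A \<sigma> q))) z)"
    using Times.IH(2)[of "\<lambda>x. h (mult A (word_val A \<sigma> p) x)" for p] Times.prems word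
    by (intro ball_cong refl) (simp add: laws(6))
  also have "\<dots> \<longleftrightarrow> (\<forall>p\<in>words s. \<forall>q\<in>words t. below A (h (word_val A \<sigma> (p @ q))) z)"
    using Nil_notin_words by (intro ball_cong refl) (metis word_val_append)
  finally show ?case by auto
qed

lemma eval_below_iff:
  "z \<in> carrier A \<Longrightarrow>
    below A (eval A \<sigma> t) z \<longleftrightarrow> (\<forall>p\<in>words t. below A (word_val A \<sigma> p) z)"
  using additive_eval_below_iff[of "\<lambda>x. x"] by simp

lemma word_below_eval: "p \<in> words t \<Longrightarrow> below A (word_val A \<sigma> p) (eval A \<sigma> t)"
  using eval_below_iff[OF eval_closed, of t t] laws(3)[OF eval_closed eval_closed eval_closed, of t]
  unfolding below_def by blast

end

section \<open>Words below a term in \<open>S\<^sub>7\<^sup>0\<close>\<close>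

definition occs :: "nat set \<Rightarrow> nat list \<Rightarrow> nat" where
  "occs Z w = length (filter (\<lambda>x. x \<in> Z) w)"

lemma occs_simps [simp]:
  "occs Z [] = 0" "occs Z (x # w) = (if x \<in> Z then Suc (occs Z w) else occs Z w)"
  by (simp_all add: occs_def)

definition mark :: "nat set \<Rightarrow> nat set \<Rightarrow> nat \<Rightarrow> s7 option" where
  "mark C Z x = (if x \<notin> C then None else if x \<in> Z then Some A7 else Some One7)"

definition a_power :: "nat \<Rightarrow> s7" where
  "a_power n = (if n = 0 then One7 else if n = 1 then A7 else Zero7)"

lemma word_val_mark:
  "w \<noteq> [] \<Longrightarrow> word_val S70 (mark C Z) w =
     (if set w \<subseteq> C then Some (a_power (occs Z w)) else None)"
  by (induction w rule: induct_list012) (auto simp: mark_def S70_def a_power_def)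

lemma valued_S70: "valued_ai_semiring S70 \<sigma>"
  by unfold_locales (simp_all add: ai_semiring_S70, simp add: S70_def)

text \<open>
  Assign \<open>a\<close> to the letters of \<open>q\<close> in \<open>Z\<close>, \<open>1\<close> to its other letters and \<open>\<infinity>\<close> to all remaining
  variables.  This erases from \<open>t\<close> the words with a letter outside \<open>q\<close>, and a word that
  survives takes the value \<open>a\<^sup>n\<close>, where \<open>n\<close> counts its letters in \<open>Z\<close>.  If \<open>n\<close> is the same
  number \<open>k\<close>, \<open>0\<close> or \<open>1\<close>, for all these words, then \<open>a\<^sup>k\<close> is an upper bound for \<open>t\<close>, hence for \<open>q\<close>.
  Strictly below \<open>1\<close> and \<open>a\<close> there is only \<open>\<infinity>\<close>, which is not the value of \<open>q\<close>.
\<close>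

lemma occs_eq_if_satisfies_S70:
  assumes sat: "satisfies S70 (s, t)" and q: "q \<in> words s" and k: "k \<le> 1"
    and t: "\<And>p. p \<in> words t \<Longrightarrow> set p \<subseteq> set q \<Longrightarrow> occs Z p = k"
  shows "occs Z q = k"
proof -
  define \<sigma> where "\<sigma> = mark (set q) Z"
  interpret valued_ai_semiring S70 \<sigma> by (rule valued_S70)
  have carr: "x \<in> carrier S70" for x by (simp add: S70_def)
  have ne: "w \<noteq> []" if "w \<in> words u" for w u using that Nil_notin_words by metis
  have "below S70 (word_val S70 \<sigma> p) (Some (a_power k))" if "p \<in> words t" for p
    using t[OF that] ne[OF that]
    by (simp add: \<sigma>_def word_val_mark below_def) (simp add: S70_def s7_add_def)
  then have "below S70 (eval S70 \<sigma> t) (Some (a_power k))" by (simp add: eval_below_iff carr)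
  moreover have "eval S70 \<sigma> s = eval S70 \<sigma> t" using sat carr by (simp add: satisfies_def)
  ultimately have "below S70 (eval S70 \<sigma> s) (Some (a_power k))" by simp
  then have "below S70 (word_val S70 \<sigma> q) (Some (a_power k))"
    using q by (simp add: eval_below_iff carr)
  then have "below S70 (Some (a_power (occs Z q))) (Some (a_power k))"
    using ne[OF q] by (simp add: \<sigma>_def word_val_mark)
  then show ?thesis
    using k by (auto simp: below_def S70_def s7_add_def a_power_def split: if_splits)
qed

text \<open>
  Otherwise, giving \<open>a\<close> to \<open>x\<close> and \<open>1\<close> to the other letters of \<open>q\<close> would leave the value \<open>1\<close> to
  all surviving words of \<open>t\<close>, but not to \<open>q\<close>.
\<close>

lemma letter_covered_if_satisfies_S70:
  assumes "satisfies S70 (s, t)" "q \<in> words s" "x \<in> set q"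
  obtains p where "p \<in> words t" "set p \<subseteq> set q" "x \<in> set p"
proof -
  have occs0: "occs {x} w = 0 \<longleftrightarrow> x \<notin> set w" for w by (induction w) auto
  then show thesis using occs_eq_if_satisfies_S70[OF assms(1,2), of 0 "{x}"] assms(3) that by auto
qed

section \<open>The semiring of a graph\<close>

text \<open>
  For a finite symmetric graph with at least one edge, the nonempty sets of vertices together
  with \<open>Edge\<close> and \<open>Top\<close> form a quotient of the free commutative ai-semiring on the vertices.
  The elements of the latter are finite sums of words; \<open>Verts U\<close> is the sum of the one-letter words in \<open>U\<close>,
  all sums of words \<open>u w\<close> with adjacent \<open>u\<close> and \<open>w\<close> are identified to \<open>Edge\<close>, and all remaining
  sums, which form an ideal closed under adding any element, are identified to \<open>Top\<close>.
\<close>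

datatype 'v gel = Top | Edge | Verts "'v set"

fun gel_add :: "'v gel \<Rightarrow> 'v gel \<Rightarrow> 'v gel" where
  "gel_add Edge Edge = Edge"
| "gel_add (Verts U) (Verts W) = Verts (U \<union> W)"
| "gel_add _ _ = Top"

fun gel_mult :: "('v \<Rightarrow> 'v \<Rightarrow> bool) \<Rightarrow> 'v gel \<Rightarrow> 'v gel \<Rightarrow> 'v gel" where
  "gel_mult adj (Verts U) (Verts W) = (if \<forall>u\<in>U. \<forall>w\<in>W. adj u w then Edge else Top)"
| "gel_mult adj _ _ = Top"

text \<open>
  The empty set of vertices has to be excluded: its square would be \<open>Edge\<close> and its cube \<open>Top\<close>,
  against the identity \<open>x x + x x x \<approx> x x\<close> of \<open>S\<^sub>7\<^sup>0\<close>.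
\<close>

definition graph_alg :: "'v set \<Rightarrow> ('v \<Rightarrow> 'v \<Rightarrow> bool) \<Rightarrow> 'v gel alg" where
  "graph_alg V adj =
     \<lparr>carrier = {Top, Edge} \<union> Verts ` {U. U \<noteq> {} \<and> U \<subseteq> V},
      add = gel_add, mult = gel_mult adj\<rparr>"

lemma gel_laws:
  "gel_add (gel_add x y) z = gel_add x (gel_add y z)" "gel_add x y = gel_add y x"
  "gel_add x x = x" "gel_mult adj (gel_mult adj x y) z = gel_mult adj x (gel_mult adj y z)"
  "gel_mult adj (gel_add x y) z = gel_add (gel_mult adj x z) (gel_mult adj y z)"
  "gel_mult adj x (gel_add y z) = gel_add (gel_mult adj x y) (gel_mult adj x z)"
  by (cases x; cases y; cases z; auto)+

lemma ai_semiring_graph_alg: "ai_semiring (graph_alg V adj)"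
  unfolding ai_semiring_def algebra_def graph_alg_def alg.simps
  by (intro conjI ballI; (rule gel_laws)?) (auto split: if_splits)

lemma below_gel:
  "below (graph_alg V adj) x Edge \<longleftrightarrow> x = Edge"
  "below (graph_alg V adj) x (Verts W) \<longleftrightarrow> (\<exists>U\<subseteq>W. x = Verts U)"
  "below (graph_alg V adj) x Top"
  by (cases x; auto simp: below_def graph_alg_def)+

definition bipartite_on :: "('v \<Rightarrow> 'v \<Rightarrow> bool) \<Rightarrow> 'v set \<Rightarrow> bool" where
  "bipartite_on adj W \<longleftrightarrow> (\<exists>c :: 'v \<Rightarrow> bool. \<forall>u\<in>W. \<forall>v\<in>W. adj u v \<longrightarrow> c u \<noteq> c v)"

text \<open>A product of two elements is never a set of vertices, and a triple product is \<^const>\<open>Top\<close>.\<close>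

lemma word_val_gel_Verts:
  "w \<noteq> [] \<Longrightarrow> word_val (graph_alg V adj) \<phi> w = Verts U \<Longrightarrow> \<exists>x. w = [x] \<and> \<phi> x = Verts U"
proof (cases w rule: remdups_adj.cases)
  case (3 x y v)
  assume "word_val (graph_alg V adj) \<phi> w = Verts U"
  then show ?thesis using 3
    by (cases "\<phi> x"; cases "word_val (graph_alg V adj) \<phi> (y # v)")
       (auto simp: graph_alg_def split: if_splits)
qed auto

lemma word_val_gel_Edge:
  assumes "w \<noteq> []" "word_val (graph_alg V adj) \<phi> w = Edge"
  shows "(\<exists>x. w = [x] \<and> \<phi> x = Edge) \<or>
    (\<exists>x y U W. w = [x, y] \<and> \<phi> x = Verts U \<and> \<phi> y = Verts W \<and> (\<forall>u\<in>U. \<forall>w\<in>W. adj u w))"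
proof (cases w rule: remdups_adj.cases)
  case (3 x y v)
  let ?r = "word_val (graph_alg V adj) \<phi> (y # v)"
  have "gel_mult adj (\<phi> x) ?r = Edge" using assms 3 by (simp add: graph_alg_def)
  then obtain U W where UW: "\<phi> x = Verts U" "?r = Verts W" "\<forall>u\<in>U. \<forall>w\<in>W. adj u w"
    by (cases "\<phi> x"; cases ?r) (auto split: if_splits)
  then show ?thesis using word_val_gel_Verts[OF _ UW(2)] 3 by auto
qed (use assms in auto)

text \<open>
  Here all words of \<open>t\<close> are single letters.  Counting all letters, that is taking
  \<open>Z = UNIV\<close>, shows that \<open>q\<close> is a single letter too, and then it is one of the words of \<open>t\<close>.
\<close>

lemma word_below_Verts:
  assumes sat: "satisfies S70 (s, t)" and q: "q \<in> words s"
    and \<phi>: "\<And>n. \<phi> n \<in> carrier (graph_alg V adj)"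
    and t: "eval (graph_alg V adj) \<phi> t = Verts U"
  shows "below (graph_alg V adj) (word_val (graph_alg V adj) \<phi> q) (Verts U)"
proof -
  interpret valued_ai_semiring "graph_alg V adj" \<phi>
    using \<phi> by unfold_locales (simp_all add: ai_semiring_graph_alg)
  have single: "length p = 1" if p: "p \<in> words t" for p
  proof -
    obtain U' where "word_val (graph_alg V adj) \<phi> p = Verts U'"
      using word_below_eval[OF p] by (auto simp: t below_gel)
    moreover have "p \<noteq> []" using p Nil_notin_words by metis
    ultimately show ?thesis using word_val_gel_Verts[of p V adj \<phi> U'] by auto
  qed
  have "length q = 1"
    using occs_eq_if_satisfies_S70[OF sat q, of 1 UNIV] single by (simp add: occs_def)
  then obtain x where x: "q = [x]" by (cases q) auto
  obtain p where p: "p \<in> words t" "x \<in> set p"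
    using letter_covered_if_satisfies_S70[OF sat q, of x] x by auto
  then have "p = q" using single[OF p(1)] x by (cases p) auto
  then show ?thesis using word_below_eval[OF p(1)] t by simp
qed

text \<open>
  The two colour classes of a 2-colouring give two sets \<open>Z\<close> of letters, and every word of \<open>t\<close>
  has exactly one letter in each of them.  By \<open>occs_eq_if_satisfies_S70\<close> so does \<open>q\<close>.
  The two sets cover all letters of \<open>q\<close>, hence \<open>q\<close> has at most two letters, and the words of \<open>t\<close>
  that cover these letters determine the value of \<open>q\<close>.
\<close>

lemma word_below_Edge:
  fixes V :: "'v set"
  assumes sat: "satisfies S70 (s, t)" and q: "q \<in> words s"
    and \<phi>: "\<And>n. \<phi> n \<in> carrier (graph_alg V adj)"
    and t: "eval (graph_alg V adj) \<phi> t = Edge"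
    and sym: "\<And>u v. adj u v \<Longrightarrow> adj v u"
    and bip: "\<And>W. W \<subseteq> V \<Longrightarrow> finite W \<Longrightarrow> card W \<le> card (vars t) \<Longrightarrow>
      bipartite_on adj W"
  shows "word_val (graph_alg V adj) \<phi> q = Edge"
proof -
  let ?G = "graph_alg V adj"
  interpret valued_ai_semiring ?G \<phi>
    using \<phi> by unfold_locales (simp_all add: ai_semiring_graph_alg)
  have verts: "U \<noteq> {} \<and> U \<subseteq> V" if "\<phi> x = Verts U" for x U
    using \<phi>[of x] that by (auto simp: graph_alg_def)
  define f where "f x = (SOME v. \<exists>U. \<phi> x = Verts U \<and> v \<in> U)" for x
  have f: "f x \<in> U" if "\<phi> x = Verts U" for x U
    using verts[OF that] that someI_ex[of "\<lambda>v. v \<in> U"] by (auto simp: f_def)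
  define W where "W = f ` {x \<in> vars t. \<exists>U. \<phi> x = Verts U}"
  have "W \<subseteq> V" using verts f unfolding W_def by blast
  moreover have "finite W" by (simp add: W_def finite_vars)
  moreover have "card W \<le> card (vars t)"
    unfolding W_def
    by (rule order_trans[OF card_image_le card_mono]) (auto simp: finite_vars)
  ultimately have "bipartite_on adj W" by (rule bip)
  then obtain c :: "'v \<Rightarrow> bool" where c: "\<forall>u\<in>W. \<forall>v\<in>W. adj u v \<longrightarrow> c u \<noteq> c v"
    unfolding bipartite_on_def by blast
  have t_word: "(\<exists>x. p = [x] \<and> \<phi> x = Edge) \<or>
      (\<exists>x y U W. p = [x, y] \<and> \<phi> x = Verts U \<and> \<phi> y = Verts W \<and> c (f x) \<noteq> c (f y) \<and>
        (\<forall>u\<in>U. \<forall>w\<in>W. adj u w))" if p: "p \<in> words t" for p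
  proof -
    have "word_val ?G \<phi> p = Edge" using word_below_eval[OF p] by (simp add: t below_gel)
    moreover have "p \<noteq> []" using p Nil_notin_words by metis
    moreover have "c (f x) \<noteq> c (f y)" if "p = [x, y]" "\<phi> x = Verts U" "\<phi> y = Verts U'"
      "\<forall>u\<in>U. \<forall>w\<in>U'. adj u w" for x y U U'
    proof -
      have "set p \<subseteq> vars t" using p by (auto simp: vars_def)
      then have "x \<in> vars t" "y \<in> vars t" using that(1) by simp_all
      then have "f x \<in> W" "f y \<in> W" using that unfolding W_def by blast+
      then show ?thesis using c f[OF that(2)] f[OF that(3)] that(4) by blast
    qed
    ultimately show ?thesis using word_val_gel_Edge[of p V adj \<phi>] by blast
  qed
  \<comment> \<open>Letters with value \<^const>\<open>Edge\<close> are words of \<open>t\<close> by themselves, so they count for both colours.\<close>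
  define Z where "Z b = {x. \<phi> x = Edge \<or> (\<exists>U. \<phi> x = Verts U) \<and> c (f x) = b}" for b
  have occsZ: "occs (Z b) q = 1" for b
  proof (rule occs_eq_if_satisfies_S70[OF sat q])
    fix p assume "p \<in> words t"
    then show "occs (Z b) p = 1" using t_word[of p] by (cases b) (auto simp: Z_def)
  qed simp
  have covered: "\<exists>p\<in>words t. set p \<subseteq> set q \<and> x \<in> set p" if "x \<in> set q" for x
    using letter_covered_if_satisfies_S70[OF sat q that] by blast
  have letters: "x \<in> Z True \<union> Z False" if x: "x \<in> set q" for x
  proof -
    obtain p where "p \<in> words t" "x \<in> set p" using covered[OF x] by blast
    then show ?thesis using t_word[of p] by (auto simp: Z_def)
  qed
  have "set w \<subseteq> Z True \<union> Z False \<Longrightarrow> length w \<le> occs (Z True) w + occs (Z False) w" for w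
    by (induction w) auto
  then have "length q \<le> 2" using occsZ[of True] occsZ[of False] letters by (metis one_add_one subsetI)
  moreover have "q \<noteq> []" using q Nil_notin_words by metis
  ultimately consider x where "q = [x]" | x y where "q = [x, y]"
    by (cases q rule: remdups_adj.cases) (auto simp: le_Suc_eq)
  then show ?thesis
  proof cases
    case 1
    then obtain p where "p \<in> words t" "set p \<subseteq> {x}" using covered[of x] by auto
    then show ?thesis using t_word[of p] 1 by auto
  next
    case 2
    \<comment> \<open>Otherwise \<open>x\<close> counts for both colours, and \<open>y\<close> for one of them, which then has count 2.\<close>
    then have "\<phi> x \<noteq> Edge"
      using occsZ[of True] occsZ[of False] letters[of y] by (auto simp: Z_def split: if_splits)
    \<comment> \<open>The word of \<open>t\<close> that covers \<open>x\<close> is now \<open>x y\<close> or \<open>y x\<close>: it is not \<open>x x\<close>, as its letters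
      have different colours.\<close>
    moreover obtain p where "p \<in> words t" "set p \<subseteq> {x, y}" "x \<in> set p"
      using covered[of x] 2 by auto
    ultimately have "gel_mult adj (\<phi> x) (\<phi> y) = Edge \<or> gel_mult adj (\<phi> y) (\<phi> x) = Edge"
      using t_word[of p] by auto
    moreover have "gel_mult adj a b = gel_mult adj b a" for a b
      by (cases a; cases b; simp) (use sym in blast)
    ultimately show ?thesis using 2 by (simp add: graph_alg_def)
  qed
qed

theorem graph_alg_satisfies:
  fixes V :: "'v set"
  assumes sat: "satisfies S70 (s, t)"
    and sym: "\<And>u v. adj u v \<Longrightarrow> adj v u"
    and bip: "\<And>W. W \<subseteq> V \<Longrightarrow> finite W \<Longrightarrow> card W \<le> max (card (vars s)) (card (vars t)) \<Longrightarrow>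
      bipartite_on adj W"
  shows "satisfies (graph_alg V adj) (s, t)"
  unfolding satisfies_def
proof (intro allI impI, simp only: fst_conv snd_conv)
  let ?G = "graph_alg V adj"
  fix \<phi> :: "nat \<Rightarrow> 'v gel" assume \<phi>: "\<forall>n. \<phi> n \<in> carrier ?G"
  interpret valued_ai_semiring ?G \<phi>
    using \<phi> by unfold_locales (simp_all add: ai_semiring_graph_alg)
  have "below ?G (eval ?G \<phi> s') (eval ?G \<phi> t')"
    if "satisfies S70 (s', t')" "card (vars t') \<le> max (card (vars s)) (card (vars t))" for s' t'
  proof (cases "eval ?G \<phi> t'")
    case Edge
    have "word_val ?G \<phi> q = Edge" if "q \<in> words s'" for q
      using word_below_Edge[OF \<open>satisfies S70 (s', t')\<close> that \<sigma> Edge sym] bip that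
        \<open>card (vars t') \<le> _\<close> order_trans by blast
    then show ?thesis using eval_below_iff[OF eval_closed, of s' t'] Edge by (simp add: below_gel)
  next
    case (Verts U)
    then show ?thesis
      using word_below_Verts[OF that(1) _ \<sigma> Verts] eval_below_iff[OF eval_closed] by metis
  qed (simp add: below_gel)
  moreover have "satisfies S70 (t, s)" using sat by (auto simp: satisfies_def)
  ultimately show "eval ?G \<phi> s = eval ?G \<phi> t" using sat by (intro below_antisym) auto
qed

section \<open>Odd cycles\<close>

definition cycle_adj :: "nat \<Rightarrow> nat \<Rightarrow> nat \<Rightarrow> bool" where
  "cycle_adj n i j \<longleftrightarrow> j = Suc i \<or> i = Suc j \<or> {i, j} = {0, n}"

lemma proper_subset_of_cycle_bipartite:
  assumes "even n" "W \<subseteq> {..n}" "card W \<le> n"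
  shows "bipartite_on (cycle_adj n) W"
proof -
  have "W \<noteq> {..n}" using assms(3) by auto
  then obtain m where m: "m \<le> n" "m \<notin> W" using assms(2) by auto
  \<comment> \<open>Going once around the path from \<open>m + 1\<close> to \<open>n\<close> and on from \<open>0\<close> to \<open>m - 1\<close>, the colours
    alternate: \<open>n\<close> and \<open>0\<close> are both even, so the parity is flipped below \<open>m\<close>.\<close>
  define c where "c i \<longleftrightarrow> even i \<noteq> (i < m)" for i
  have "c u \<noteq> c v" if "u \<in> W" "v \<in> W" "cycle_adj n u v" for u v
  proof -
    have ne: "u \<noteq> m" "v \<noteq> m" using that m by auto
    have "v = Suc u \<or> u = Suc v \<or> u = 0 \<and> v = n \<or> u = n \<and> v = 0"
      using that(3) unfolding cycle_adj_def doubleton_eq_iff by blast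
    then show ?thesis using ne m(1) assms(1) by (elim disjE conjE) (auto simp: c_def)
  qed
  then show ?thesis unfolding bipartite_on_def by blast
qed

primrec path_sum :: "trm \<Rightarrow> nat \<Rightarrow> trm" where
  "path_sum t 0 = t"
| "path_sum t (Suc i) = Plus (path_sum t i) (Times (Var i) (Var (Suc i)))"

definition cycle_sum :: "nat \<Rightarrow> trm" where
  "cycle_sum n = path_sum (Times (Var 0) (Var n)) n"

primrec var_prod :: "nat \<Rightarrow> trm" where
  "var_prod 0 = Var 0"
| "var_prod (Suc i) = Times (var_prod i) (Var (Suc i))"

definition cycle_identity :: "nat \<Rightarrow> identity" where
  "cycle_identity n = (Plus (cycle_sum n) (var_prod n), cycle_sum n)"

lemma words_path_sum: "words (path_sum t n) = words t \<union> {[i, Suc i] | i. i < n}"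
  by (induction n) (auto simp: less_Suc_eq)

lemma words_var_prod: "words (var_prod n) = {[0..<Suc n]}"
  by (induction n) auto

lemma words_cycle_sum: "words (cycle_sum n) = insert [0, n] {[i, Suc i] | i. i < n}"
  by (simp add: cycle_sum_def words_path_sum)

lemma S70_cycle_identity:
  assumes "even n"
  shows "satisfies S70 (cycle_identity n)"
  unfolding satisfies_def
proof (intro allI impI)
  fix \<sigma> :: "nat \<Rightarrow> s7 option"
  interpret valued_ai_semiring S70 \<sigma> by (rule valued_S70)
  have carr: "x \<in> carrier S70" for x by (simp add: S70_def)
  let ?t = "eval S70 \<sigma> (cycle_sum n)" and ?q = "eval S70 \<sigma> (var_prod n)"
  have edge: "below S70 (s70_mult (\<sigma> i) (\<sigma> j)) ?t"
    if "[i, j] \<in> words (cycle_sum n)" for i j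
    using word_below_eval[OF that] by (simp add: S70_def)
  have none: "?q = None" if "i \<le> n" "\<sigma> i = None" for i
  proof -
    have "i \<le> m \<Longrightarrow> eval S70 \<sigma> (var_prod m) = None" for m
      using that(2) by (induction m) (auto simp: le_Suc_eq S70_def elim: s70_mult.elims)
    then show ?thesis using that(1) by blast
  qed
  have "below S70 ?q ?t"
  proof (cases "\<exists>i\<le>n. \<sigma> i = None")
    case True
    then show ?thesis using none by (auto simp: below_def S70_def)
  next
    case False
    then have "\<exists>y. \<sigma> i = Some y" if "i \<le> n" for i using that by auto
    then obtain g where g: "\<And>i. i \<le> n \<Longrightarrow> \<sigma> i = Some (g i)" by metis
    have g_edge: "\<exists>z. ?t = Some z \<and> (z = Zero7 \<or> s7_mult (g i) (g j) = z)"
      if "[i, j] \<in> words (cycle_sum n)" "i \<le> n" "j \<le> n" for i j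
      using edge[OF that(1)] g that(2,3)
      by (cases ?t) (auto simp: below_def S70_def s7_add_def split: if_splits)
    obtain z where z: "?t = Some z" and wrap: "z = Zero7 \<or> s7_mult (g 0) (g n) = z"
      using g_edge[of 0 n] by (auto simp: words_cycle_sum)
    have step: "s7_mult (g i) (g (Suc i)) = z" if "i < n" "z \<noteq> Zero7" for i
      using g_edge[of i "Suc i"] that z by (auto simp: words_cycle_sum)
    show ?thesis
    proof (cases z)
      case Zero7
      then show ?thesis using z by (cases ?q) (auto simp: below_def S70_def s7_add_def)
    next
      case One7
      have inv: "s7_mult x y = One7 \<longleftrightarrow> x = One7 \<and> y = One7" for x y
        by (cases x; cases y) auto
      have one: "g i = One7" if "i \<le> n" for i
        using that wrap step[of i] One7 by (cases "i = n") (auto simp: inv)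
      have "m \<le> n \<Longrightarrow> eval S70 \<sigma> (var_prod m) = Some One7" for m
      proof (induction m)
        case 0
        then show ?case using g[of 0] one[of 0] by simp
      next
        case (Suc m)
        then show ?case using g[of "Suc m"] one[of "Suc m"] by (simp add: S70_def)
      qed
      then show ?thesis using z One7 by (simp add: below_def S70_def s7_add_def)
    next
      case A7
      have alt: "s7_mult x y = A7 \<longleftrightarrow> x = One7 \<and> y = A7 \<or> x = A7 \<and> y = One7" for x y
        by (cases x; cases y) auto
      have "i \<le> n \<Longrightarrow> g i \<in> {One7, A7} \<and> (g i = g 0 \<longleftrightarrow> even i)" for i
      proof (induction i)
        case 0
        then show ?case using wrap A7 by (auto simp: alt)
      next
        case (Suc i)
        then show ?case using step[of i] wrap A7 by (auto simp: alt)
      qed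
      then have "g n = g 0" using assms by blast
      then have False using wrap A7 by (auto simp: alt)
      then show ?thesis ..
    qed
  qed
  then show "eval S70 \<sigma> (fst (cycle_identity n)) = eval S70 \<sigma> (snd (cycle_identity n))"
    using laws(2)[OF eval_closed eval_closed carr] by (simp add: below_def cycle_identity_def)
qed

lemma cycle_alg_violates_cycle_identity:
  assumes "2 \<le> n"
  shows "\<not> satisfies (graph_alg {..n} (cycle_adj n)) (cycle_identity n)"
proof
  let ?G = "graph_alg {..n} (cycle_adj n)"
  \<comment> \<open>The minimum only serves to give the variables beyond \<open>n\<close> a value in the carrier.\<close>
  define \<phi> where "\<phi> i = Verts {min i n}" for i
  have \<phi>: "\<phi> i \<in> carrier ?G" for i by (simp add: \<phi>_def graph_alg_def)
  interpret valued_ai_semiring ?G \<phi>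
    using \<phi> by unfold_locales (simp_all add: ai_semiring_graph_alg)
  assume "satisfies ?G (cycle_identity n)"
  then have "eval ?G \<phi> (Plus (cycle_sum n) (var_prod n)) = eval ?G \<phi> (cycle_sum n)"
    using \<phi> by (simp add: satisfies_def cycle_identity_def)
  moreover have "below ?G (eval ?G \<phi> (cycle_sum n)) Edge"
    by (subst eval_below_iff)
       (auto simp: words_cycle_sum below_def graph_alg_def \<phi>_def cycle_adj_def)
  ultimately have "below ?G (eval ?G \<phi> (Plus (cycle_sum n) (var_prod n))) Edge" by simp
  moreover have "[0..<Suc n] \<in> words (Plus (cycle_sum n) (var_prod n))"
    using words_var_prod[of n] by simp
  moreover have Edge: "Edge \<in> carrier ?G" by (simp add: graph_alg_def)
  ultimately have "below ?G (word_val ?G \<phi> [0..<Suc n]) Edge"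
    using eval_below_iff[OF Edge] by blast
  then have "word_val ?G \<phi> [0..<Suc n] = Edge" by (simp only: below_gel)
  then have "length [0..<Suc n] \<le> 2"
    using word_val_gel_Edge[of "[0..<Suc n]" "{..n}" "cycle_adj n" \<phi>]
    by (auto dest: arg_cong[where f = length] simp del: upt_Suc)
  then show False using assms by simp
qed

section \<open>Varieties and isomorphic copies\<close>

lemma eval_in_carrier: "algebra A \<Longrightarrow> (\<And>n. \<sigma> n \<in> carrier A) \<Longrightarrow> eval A \<sigma> t \<in> carrier A"
  by (induction t) (auto simp: algebra_def)

lemma homomorphism_eval:
  assumes "homomorphism h A B" "algebra A" "\<And>n. \<sigma> n \<in> carrier A"
  shows "h (eval A \<sigma> t) = eval B (h \<circ> \<sigma>) t"
  using assms by (induction t) (simp_all add: homomorphism_def eval_in_carrier)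

lemma in_variety_satisfies:
  fixes A :: "'a alg" and B :: "'b alg"
  assumes "in_variety A B" and sat: "satisfies A e"
  shows "satisfies B e"
  unfolding satisfies_def
proof (intro allI impI)
  obtain I :: "('b \<Rightarrow> 'a) set" and C h where C: "subalgebra C (power_alg A I)"
    and h: "homomorphism h C B" "h ` carrier C = carrier B"
    using assms(1) unfolding in_variety_def in_HSP_def by blast
  fix \<tau> :: "nat \<Rightarrow> 'b" assume "\<forall>n. \<tau> n \<in> carrier B"
  then have "\<forall>n. \<exists>x\<in>carrier C. h x = \<tau> n" using h(2) by (metis imageE)
  then obtain \<sigma> where \<sigma>: "\<And>n. \<sigma> n \<in> carrier C" "\<And>n. h (\<sigma> n) = \<tau> n" by metis
  have algC: "algebra C" and sub: "carrier C \<subseteq> I \<rightarrow>\<^sub>E carrier A"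
    using C by (simp_all add: subalgebra_def power_alg_def)
  have ev: "eval C \<sigma> u \<in> carrier C" for u using algC \<sigma>(1) by (rule eval_in_carrier)
  have coord: "eval C \<sigma> u i = eval A (\<lambda>n. \<sigma> n i) u" if "i \<in> I" for u i
    using C that ev by (induction u) (simp_all add: subalgebra_def power_alg_def)
  have "\<sigma> n i \<in> carrier A" if "i \<in> I" for n i using sub \<sigma>(1)[of n] that by blast
  then have "eval C \<sigma> (fst e) i = eval C \<sigma> (snd e) i" if "i \<in> I" for i
    using coord[OF that] sat that by (simp add: satisfies_def)
  moreover have "eval C \<sigma> u \<in> extensional I" for u using sub ev[of u] by (auto simp: PiE_def)
  ultimately have "eval C \<sigma> (fst e) = eval C \<sigma> (snd e)" by (metis extensionalityI)
  moreover have "h (eval C \<sigma> u) = eval B \<tau> u" for u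
    using homomorphism_eval[OF h(1) algC \<sigma>(1)] \<sigma>(2) by (simp add: comp_def)
  ultimately show "eval B \<tau> (fst e) = eval B \<tau> (snd e)" by metis
qed

lemma homomorphic_image_in_variety:
  assumes "algebra A" "algebra B" "homomorphism h A B" "h ` carrier A = carrier B"
  shows "in_variety A B"
proof -
  let ?P = "power_alg A (UNIV :: unit set)"
  have "algebra ?P" using assms(1) by (auto simp: algebra_def power_alg_def PiE_def)
  then have 1: "subalgebra ?P ?P" by (simp add: subalgebra_def)
  have 2: "homomorphism (\<lambda>x. h (x ())) ?P B"
    using assms(3) by (auto simp: homomorphism_def power_alg_def PiE_def Pi_def)
  have "b \<in> (\<lambda>x. h (x ())) ` carrier ?P" if b: "b \<in> carrier B" for b
  proof -
    have "b \<in> h ` carrier A" using b assms(4) by simp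
    then obtain a where "a \<in> carrier A" "b = h a" by (rule imageE)
    then have "b = h ((\<lambda>_. a) ())" "(\<lambda>_. a) \<in> carrier ?P"
      by (simp_all add: power_alg_def PiE_UNIV_domain)
    then show ?thesis by (rule image_eqI)
  qed
  moreover have "(\<lambda>x. h (x ())) ` carrier ?P \<subseteq> carrier B"
    using 2 unfolding homomorphism_def by blast
  ultimately have 3: "(\<lambda>x. h (x ())) ` carrier ?P = carrier B" by blast
  have "in_HSP (UNIV :: unit set) A B"
    unfolding in_HSP_def using assms(2) 1 2 3 by (intro conjI exI)
  then show ?thesis by (rule in_HSP_imp_in_variety)
qed

text \<open>
  Satisfaction of identities passes along both memberships, so the copy satisfies exactly the
  identities of the original.  This carries \<open>S\<^sub>7\<^sup>0\<close> and the semirings of cycles over to the type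
  on which the defining property of a basis is tested.
\<close>

lemma finite_algebra_copy:
  fixes A :: "'a alg"
  assumes A: "algebra A" "finite (carrier A)" and "infinite (UNIV :: 'u set)"
  obtains B :: "'u alg" where "algebra B" "in_variety A B" "in_variety B A"
proof -
  obtain T :: "'u set" where "finite T" "card T = card (carrier A)"
    using infinite_arbitrarily_large[OF assms(3)] by metis
  then obtain g where "bij_betw g (carrier A) T" using A(2) finite_same_card_bij by metis
  then have inj: "inj_on g (carrier A)" by (simp add: bij_betw_def)
  define k where "k = inv_into (carrier A) g"
  have kg: "k (g x) = x" if "x \<in> carrier A" for x using inj that by (simp add: k_def)
  define B where "B = \<lparr>carrier = g ` carrier A, add = \<lambda>x y. g (add A (k x) (k y)),
    mult = \<lambda>x y. g (mult A (k x) (k y))\<rparr>"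
  have cl: "add A x y \<in> carrier A" "mult A x y \<in> carrier A"
    if "x \<in> carrier A" "y \<in> carrier A" for x y
    using A(1) that by (auto simp: algebra_def)
  have algB: "algebra B" using A(1) by (auto simp: algebra_def B_def kg)
  have "homomorphism g A B" by (auto simp: homomorphism_def B_def kg)
  then have AB: "in_variety A B"
    by (rule homomorphic_image_in_variety[OF A(1) algB]) (simp add: B_def)
  have "homomorphism k B A" by (auto simp: homomorphism_def B_def kg cl)
  then have "in_variety B A"
    by (rule homomorphic_image_in_variety[OF algB A(1)]) (auto simp: B_def kg image_image)
  then show thesis using that algB AB by blast
qed

section \<open>The variety has no finite basis\<close>

theorem corollary2p4:
  assumes "infinite (UNIV :: 'u set)"
  shows "\<not> finitely_based TYPE('u) S70"
proof
  assume "finitely_based TYPE('u) S70"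
  then obtain E :: "identity set" where "finite E \<and>
      (\<forall>B :: 'u alg. algebra B \<longrightarrow> (in_variety S70 B \<longleftrightarrow> (\<forall>e\<in>E. satisfies B e)))"
    unfolding finitely_based_def ..
  then have fin: "finite E" and
    E: "\<And>B :: 'u alg. algebra B \<Longrightarrow> in_variety S70 B \<longleftrightarrow> (\<forall>e\<in>E. satisfies B e)"
    by simp_all
  have "x \<in> {One7, A7, Zero7}" for x by (cases x) auto
  then have "finite (UNIV :: s7 set)" by (intro finite_subset[of UNIV "{One7, A7, Zero7}"]) blast+
  then have "finite (carrier S70)" "algebra S70"
    by (simp_all add: S70_def algebra_def finite_option_UNIV)
  then obtain S :: "'u alg" where S: "algebra S" "in_variety S70 S" "in_variety S S70"
    using finite_algebra_copy assms by metis
  have S70_E: "satisfies S70 (s, t)" if "(s, t) \<in> E" for s t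
    using E[OF S(1)] S(2) in_variety_satisfies[OF S(3)] that by blast
  \<comment> \<open>Even and at least 2, and no side of an identity in \<open>E\<close> has more than \<open>n\<close> variables.\<close>
  define n where "n = 2 * Suc (\<Sum>(s, t)\<in>E. card (vars s) + card (vars t))"
  have n: "even n" "2 \<le> n" by (simp_all add: n_def)
  have bound: "max (card (vars s)) (card (vars t)) \<le> n" if "(s, t) \<in> E" for s t
    using member_le_sum[OF that, of "\<lambda>(s, t). card (vars s) + card (vars t)"] fin
    by (simp add: n_def)
  let ?G = "graph_alg {..n} (cycle_adj n)"
  have G_E: "satisfies ?G (s, t)" if "(s, t) \<in> E" for s t
  proof (rule graph_alg_satisfies[OF S70_E[OF that]])
    show "cycle_adj n v u" if "cycle_adj n u v" for u v
      using that unfolding cycle_adj_def doubleton_eq_iff by blast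
    show "bipartite_on (cycle_adj n) W"
      if "W \<subseteq> {..n}" "card W \<le> max (card (vars s)) (card (vars t))" for W
      using that(2) bound[OF \<open>(s, t) \<in> E\<close>]
      by (intro proper_subset_of_cycle_bipartite[OF n(1) that(1)]) (rule order_trans)
  qed
  have "finite (carrier ?G)" by (simp add: graph_alg_def)
  moreover have "algebra ?G" using ai_semiring_graph_alg by (auto simp: ai_semiring_def)
  ultimately obtain B :: "'u alg" where B: "algebra B" "in_variety ?G B" "in_variety B ?G"
    using finite_algebra_copy assms by metis
  have "\<forall>e\<in>E. satisfies B e" using in_variety_satisfies[OF B(2)] G_E by auto
  then have "in_variety S70 B" using E[OF B(1)] by blast
  then have "satisfies ?G (cycle_identity n)"
    using in_variety_satisfies[OF B(3) in_variety_satisfies] S70_cycle_identity[OF n(1)] by blast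
  then show False using cycle_alg_violates_cycle_identity[OF n(2)] by contradiction
qed

end
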